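(* Let $K$ be a field and let $\mathcal{R}$ be the $9$-dimensional $K$-algebra with basis $\{E,X_1,X_2,Y_1,Y_2\}\cup\{F_{ij}\mid 1\le i,j\le 2\}$ and multiplication given by $E^2=E$, $F_{ij}F_{jr}=F_{ir}$, $EX_i=X_i$, $X_iF_{ir}=X_r$, $F_{ij}Y_j=Y_i$, $Y_iE=Y_i$ for all $1\le i,j,r\le 2$, any other product of two basis elements being zero. Then the group $\mathrm{Aut}(\mathcal{R})$ is isomorphic to a semidirect product $(K^2\times M_{2,1}(K))\rtimes(K^{\times}\times GL_2(K))$, and $\mathrm{Out}(\mathcal{R})\simeq K^{\times}$.
   Context: $\mathrm{Aut}(\mathcal{R})$ is the group of $K$-algebra automorphisms of $\mathcal{R}$, $\mathrm{Inn}(\mathcal{R})$ the normal subgroup of inner automorphisms $r\mapsto u^{-1}ru$ ($u\in\mathcal{R}$ invertible), and $\mathrm{Out}(\mathcal{R})=\mathrm{Aut}(\mathcal{R})/\mathrm{Inn}(\mathcal{R})$. $K^\times$ is the multiplicative group of $K$; $K^2$ (row vectors) and $M_{2,1}(K)$ (column vectors) are regarded as additive groups. The semidirect product is the one formed with respect to the action of $K^\times\times GL_2(K)$ on $K^2\times M_{2,1}(K)$ given by $(\lambda,P)\cdot(x_1,y_1)=(\lambda x_1P^{-1},Py_1)$. *)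

theory Defs
  imports
    "HOL-Analysis.Cartesian_Space"
    "HOL-Algebra.Bij"
    "HOL-Algebra.Coset"
    "HOL-Algebra.Module"
    "HOL-Algebra.QuotRing"
begin

section \<open>Automorphisms of a unital associative algebra\<close>

text \<open>
  An algebra over a field \<open>'k\<close> is a record of type \<open>('k, 'a) module\<close>: a ring together with a
  scalar multiplication. (The library's algebra locale is not used, as it asks for a commutative
  ring.) Automorphisms are extensional functions, and the group structure is composition, in
  analogy with \<open>auto\<close> and \<open>AutoGroup\<close> in \<open>HOL-Algebra.Bij\<close>.
\<close>

definition alg_auto :: "('k, 'a, 'm) module_scheme \<Rightarrow> ('a \<Rightarrow> 'a) set" where
  "alg_auto A = {f \<in> ring_iso A A \<inter> extensional (carrier A).
     \<forall>c. \<forall>x \<in> carrier A. f (c \<odot>\<^bsub>A\<^esub> x) = c \<odot>\<^bsub>A\<^esub> f x}"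

definition AlgAut :: "('k, 'a, 'm) module_scheme \<Rightarrow> ('a \<Rightarrow> 'a) monoid" where
  "AlgAut A = BijGroup (carrier A) \<lparr>carrier := alg_auto A\<rparr>"

definition inner_auto :: "('k, 'a, 'm) module_scheme \<Rightarrow> ('a \<Rightarrow> 'a) set" where
  "inner_auto A = {(\<lambda>r \<in> carrier A. inv\<^bsub>A\<^esub> u \<otimes>\<^bsub>A\<^esub> r \<otimes>\<^bsub>A\<^esub> u) | u. u \<in> Units A}"

definition AlgOut :: "('k, 'a, 'm) module_scheme \<Rightarrow> ('a \<Rightarrow> 'a) set monoid" where
  "AlgOut A = AlgAut A Mod inner_auto A"

lemma subgroup_alg_auto:
  assumes R: "ring A" and sm: "\<And>c x. x \<in> carrier A \<Longrightarrow> c \<odot>\<^bsub>A\<^esub> x \<in> carrier A"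
  shows "subgroup (alg_auto A) (BijGroup (carrier A))"
proof -
  interpret ring A by fact
  have sub: "alg_auto A \<subseteq> Bij (carrier A)"
    by (auto simp: alg_auto_def ring_iso_def Bij_def)
  show ?thesis
  proof
    show "alg_auto A \<subseteq> carrier (BijGroup (carrier A))"
      using sub by (simp add: BijGroup_def)
  next
    fix f g assume f: "f \<in> alg_auto A" and g: "g \<in> alg_auto A"
    have fg: "compose (carrier A) f g \<in> Bij (carrier A)"
      using f g sub by (blast intro: compose_Bij)
    have "g x \<in> carrier A" if "x \<in> carrier A" for x
      using g that by (auto simp: alg_auto_def ring_iso_def ring_hom_def)
    then have "compose (carrier A) f g \<in> alg_auto A"
      using f g fg sm
      by (auto simp: alg_auto_def ring_iso_def ring_hom_def compose_def Bij_def)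
    then show "f \<otimes>\<^bsub>BijGroup (carrier A)\<^esub> g \<in> alg_auto A"
      using f g sub by (auto simp: BijGroup_def)
  next
    have "(\<lambda>x\<in>carrier A. x) \<in> Bij (carrier A)" by (rule id_Bij)
    then show "\<one>\<^bsub>BijGroup (carrier A)\<^esub> \<in> alg_auto A"
      using sm by (auto simp: BijGroup_def alg_auto_def ring_iso_def ring_hom_def Bij_def)
  next
    fix f assume f: "f \<in> alg_auto A"
    let ?g = "\<lambda>x\<in>carrier A. inv_into (carrier A) f x"
    have fB: "f \<in> Bij (carrier A)" using f sub by blast
    have gB: "?g \<in> Bij (carrier A)" using fB by (rule restrict_inv_into_Bij)
    have gc: "?g x \<in> carrier A" if "x \<in> carrier A" for x
      using Bij_inv_into_mem[OF fB that] that by simp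
    have fg: "f (?g x) = x" if "x \<in> carrier A" for x
      using fB that by (simp add: Bij_def bij_betw_def f_inv_into_f)
    have uniq: "?g y = x" if "x \<in> carrier A" "f x = y" for x y
      using fB that by (auto simp: Bij_def bij_betw_def inv_into_f_f)
    have h: "f (x \<otimes>\<^bsub>A\<^esub> y) = f x \<otimes>\<^bsub>A\<^esub> f y" "f (x \<oplus>\<^bsub>A\<^esub> y) = f x \<oplus>\<^bsub>A\<^esub> f y"
      "f (c \<odot>\<^bsub>A\<^esub> x) = c \<odot>\<^bsub>A\<^esub> f x"
      if "x \<in> carrier A" "y \<in> carrier A" for x y c
      using f that by (auto simp: alg_auto_def ring_iso_def ring_hom_def)
    have f1: "f \<one>\<^bsub>A\<^esub> = \<one>\<^bsub>A\<^esub>"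
      using f by (auto simp: alg_auto_def ring_iso_def ring_hom_def)
    have "?g (x \<otimes>\<^bsub>A\<^esub> y) = ?g x \<otimes>\<^bsub>A\<^esub> ?g y" "?g (x \<oplus>\<^bsub>A\<^esub> y) = ?g x \<oplus>\<^bsub>A\<^esub> ?g y"
      "?g (c \<odot>\<^bsub>A\<^esub> x) = c \<odot>\<^bsub>A\<^esub> ?g x"
      if "x \<in> carrier A" "y \<in> carrier A" for x y c
      by (rule uniq; use gc[OF that(1)] gc[OF that(2)] h fg[OF that(1)] fg[OF that(2)] sm in
          \<open>simp del: restrict_apply\<close>)+
    moreover have "?g \<one>\<^bsub>A\<^esub> = \<one>\<^bsub>A\<^esub>"
      by (rule uniq) (simp_all add: f1)
    ultimately have "?g \<in> alg_auto A"
      using gB gc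
      by (simp add: alg_auto_def ring_iso_def ring_hom_def Bij_def Pi_iff del: restrict_apply)
    then show "inv\<^bsub>BijGroup (carrier A)\<^esub> f \<in> alg_auto A"
      using fB by (simp add: inv_BijGroup)
  qed
qed

lemma group_AlgAut:
  assumes "ring A" and "\<And>c x. x \<in> carrier A \<Longrightarrow> c \<odot>\<^bsub>A\<^esub> x \<in> carrier A"
  shows "group (AlgAut A)"
  unfolding AlgAut_def
  by (rule subgroup.subgroup_is_group[OF subgroup_alg_auto[OF assms] group_BijGroup])

lemma normal_inner_auto:
  assumes R: "ring A"
    and sm: "\<And>c x. x \<in> carrier A \<Longrightarrow> c \<odot>\<^bsub>A\<^esub> x \<in> carrier A"
    and sml: "\<And>c x y. x \<in> carrier A \<Longrightarrow> y \<in> carrier A \<Longrightarrow>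
      (c \<odot>\<^bsub>A\<^esub> x) \<otimes>\<^bsub>A\<^esub> y = c \<odot>\<^bsub>A\<^esub> (x \<otimes>\<^bsub>A\<^esub> y)"
    and smr: "\<And>c x y. x \<in> carrier A \<Longrightarrow> y \<in> carrier A \<Longrightarrow>
      x \<otimes>\<^bsub>A\<^esub> (c \<odot>\<^bsub>A\<^esub> y) = c \<odot>\<^bsub>A\<^esub> (x \<otimes>\<^bsub>A\<^esub> y)"
  shows "inner_auto A \<lhd> AlgAut A"
proof -
  interpret ring A by fact
  interpret G: group "AlgAut A" by (rule group_AlgAut[OF R sm])
  define \<iota> where "\<iota> u = (\<lambda>r\<in>carrier A. inv\<^bsub>A\<^esub> u \<otimes>\<^bsub>A\<^esub> r \<otimes>\<^bsub>A\<^esub> u)" for u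
  have inner: "inner_auto A = \<iota> ` Units A"
    by (auto simp: inner_auto_def \<iota>_def)
  have carr: "carrier (AlgAut A) = alg_auto A" by (simp add: AlgAut_def)
  have mul: "f \<otimes>\<^bsub>AlgAut A\<^esub> g = compose (carrier A) f g" if "f \<in> alg_auto A" "g \<in> alg_auto A" for f g
    using that by (auto simp: AlgAut_def BijGroup_def alg_auto_def ring_iso_def Bij_def)
  have one: "\<one>\<^bsub>AlgAut A\<^esub> = (\<lambda>x\<in>carrier A. x)" by (simp add: AlgAut_def BijGroup_def)
  have comp: "compose (carrier A) (\<iota> u) (\<iota> v) = \<iota> (v \<otimes>\<^bsub>A\<^esub> u)"
    if "u \<in> Units A" "v \<in> Units A" for u v
  proof -
    have "inv\<^bsub>A\<^esub> (v \<otimes>\<^bsub>A\<^esub> u) = inv\<^bsub>A\<^esub> u \<otimes>\<^bsub>A\<^esub> inv\<^bsub>A\<^esub> v"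
      using group.inv_mult_group[OF units_group, of v u] that
      by (simp add: units_of_carrier units_of_mult units_of_inv Units_m_closed)
    then show ?thesis
      using that Units_closed Units_inv_closed
      by (auto simp: compose_def \<iota>_def fun_eq_iff m_assoc)
  qed
  have \<iota>1: "\<iota> \<one>\<^bsub>A\<^esub> = (\<lambda>x\<in>carrier A. x)"
    by (auto simp: \<iota>_def fun_eq_iff)
  have cl: "\<iota> u r \<in> carrier A" if "u \<in> Units A" "r \<in> carrier A" for u r
    using that by (simp add: \<iota>_def Units_closed)
  have inv\<iota>: "\<iota> (inv\<^bsub>A\<^esub> u) (\<iota> u r) = r" "\<iota> u (\<iota> (inv\<^bsub>A\<^esub> u) r) = r"
    if "u \<in> Units A" "r \<in> carrier A" for u r
    using that comp[of "inv\<^bsub>A\<^esub> u" u] comp[of u "inv\<^bsub>A\<^esub> u"] \<iota>1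
    by (auto simp: compose_def fun_eq_iff dest: spec[of _ r])
  have auto: "\<iota> u \<in> alg_auto A" if u: "u \<in> Units A" for u
  proof -
    have "bij_betw (\<iota> u) (carrier A) (carrier A)"
      by (rule bij_betw_byWitness[of _ "\<iota> (inv\<^bsub>A\<^esub> u)"])
        (use u in \<open>auto simp: inv\<iota> cl\<close>)
    moreover have "\<iota> u (x \<otimes>\<^bsub>A\<^esub> y) = \<iota> u x \<otimes>\<^bsub>A\<^esub> \<iota> u y" if "x \<in> carrier A" "y \<in> carrier A" for x y
    proof -
      have "\<iota> u x \<otimes>\<^bsub>A\<^esub> \<iota> u y = inv\<^bsub>A\<^esub> u \<otimes>\<^bsub>A\<^esub> x \<otimes>\<^bsub>A\<^esub> (u \<otimes>\<^bsub>A\<^esub> inv\<^bsub>A\<^esub> u) \<otimes>\<^bsub>A\<^esub> y \<otimes>\<^bsub>A\<^esub> u"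
        using that u Units_closed[OF u] Units_inv_closed[OF u]
        by (simp add: \<iota>_def m_assoc del: Units_r_inv)
      then show ?thesis
        using that u Units_closed[OF u] Units_inv_closed[OF u] by (simp add: \<iota>_def m_assoc)
    qed
    moreover have "\<iota> u (x \<oplus>\<^bsub>A\<^esub> y) = \<iota> u x \<oplus>\<^bsub>A\<^esub> \<iota> u y" if "x \<in> carrier A" "y \<in> carrier A" for x y
      using that u by (simp add: \<iota>_def l_distr r_distr Units_closed)
    moreover have "\<iota> u \<one>\<^bsub>A\<^esub> = \<one>\<^bsub>A\<^esub>" using u by (simp add: \<iota>_def)
    moreover have "\<iota> u (c \<odot>\<^bsub>A\<^esub> x) = c \<odot>\<^bsub>A\<^esub> \<iota> u x" if "x \<in> carrier A" for c x
      using that u by (simp add: \<iota>_def sm sml smr Units_closed)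
    ultimately show ?thesis
      using u by (auto simp: alg_auto_def ring_iso_def ring_hom_def cl) (simp add: \<iota>_def)
  qed
  have inv_in: "inv\<^bsub>AlgAut A\<^esub> (\<iota> u) = \<iota> (inv\<^bsub>A\<^esub> u)" if u: "u \<in> Units A" for u
    by (rule G.inv_equality) (use u in \<open>simp_all add: mul auto comp one \<iota>1 carr\<close>)
  show ?thesis
  proof (rule G.normal_invI)
    show "subgroup (inner_auto A) (AlgAut A)"
    proof (rule G.subgroupI)
      show "inner_auto A \<noteq> {}" unfolding inner by blast
    qed (auto simp: inner carr auto inv_in mul comp)
  next
    fix f h assume f: "f \<in> carrier (AlgAut A)" and "h \<in> inner_auto A"
    then obtain u where u: "u \<in> Units A" and h: "h = \<iota> u" by (auto simp: inner)
    have f': "f \<in> alg_auto A" using f carr by simp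
    have fc: "f x \<in> carrier A" if "x \<in> carrier A" for x
      using f' that by (auto simp: alg_auto_def ring_iso_def ring_hom_def)
    have fm: "f (x \<otimes>\<^bsub>A\<^esub> y) = f x \<otimes>\<^bsub>A\<^esub> f y" if "x \<in> carrier A" "y \<in> carrier A" for x y
      using f' that by (auto simp: alg_auto_def ring_iso_def ring_hom_def)
    have f1: "f \<one>\<^bsub>A\<^esub> = \<one>\<^bsub>A\<^esub>"
      using f' by (auto simp: alg_auto_def ring_iso_def ring_hom_def)
    have lr: "f (inv\<^bsub>A\<^esub> u) \<otimes>\<^bsub>A\<^esub> f u = \<one>\<^bsub>A\<^esub>" "f u \<otimes>\<^bsub>A\<^esub> f (inv\<^bsub>A\<^esub> u) = \<one>\<^bsub>A\<^esub>"
      using u fm[of "inv\<^bsub>A\<^esub> u" u] fm[of u "inv\<^bsub>A\<^esub> u"] f1 by auto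
    have fu: "f u \<in> Units A"
      unfolding Units_def using lr fc u by auto
    have "inv\<^bsub>A\<^esub> (f u) = f (inv\<^bsub>A\<^esub> u)"
      using lr fc u by (intro inv_unique'[symmetric]) auto
    then have "compose (carrier A) f (\<iota> u) = compose (carrier A) (\<iota> (f u)) f"
      using u by (auto simp: compose_def fun_eq_iff \<iota>_def fm fc Units_closed)
    then have "f \<otimes>\<^bsub>AlgAut A\<^esub> h = \<iota> (f u) \<otimes>\<^bsub>AlgAut A\<^esub> f"
      by (simp add: h mul f' auto u fu)
    then have "f \<otimes>\<^bsub>AlgAut A\<^esub> h \<otimes>\<^bsub>AlgAut A\<^esub> inv\<^bsub>AlgAut A\<^esub> f = \<iota> (f u)"
      using f auto[OF fu, folded carr] by (simp add: G.m_assoc)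
    then show "f \<otimes>\<^bsub>AlgAut A\<^esub> h \<otimes>\<^bsub>AlgAut A\<^esub> inv\<^bsub>AlgAut A\<^esub> f \<in> inner_auto A"
      using fu by (auto simp: inner)
  qed
qed


section \<open>Semidirect products\<close>

definition semidirect ::
    "('n, 'p) monoid_scheme \<Rightarrow> ('h \<Rightarrow> 'n \<Rightarrow> 'n) \<Rightarrow> ('h, 'q) monoid_scheme \<Rightarrow> ('n \<times> 'h) monoid" where
  "semidirect N \<phi> H =
    \<lparr>carrier = carrier N \<times> carrier H,
     mult = (\<lambda>(n, h) (n', h'). (n \<otimes>\<^bsub>N\<^esub> \<phi> h n', h \<otimes>\<^bsub>H\<^esub> h')),
     one = (\<one>\<^bsub>N\<^esub>, \<one>\<^bsub>H\<^esub>)\<rparr>"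

lemma group_semidirect:
  assumes N: "group N" and H: "group H"
    and hom: "\<And>h. h \<in> carrier H \<Longrightarrow> \<phi> h \<in> hom N N"
    and one: "\<And>n. n \<in> carrier N \<Longrightarrow> \<phi> \<one>\<^bsub>H\<^esub> n = n"
    and mult: "\<And>h h' n. h \<in> carrier H \<Longrightarrow> h' \<in> carrier H \<Longrightarrow> n \<in> carrier N \<Longrightarrow>
      \<phi> (h \<otimes>\<^bsub>H\<^esub> h') n = \<phi> h (\<phi> h' n)"
  shows "group (semidirect N \<phi> H)"
proof -
  interpret N: group N by fact
  interpret H: group H by fact
  have closed: "\<phi> h n \<in> carrier N" if "h \<in> carrier H" "n \<in> carrier N" for h n
    using hom[OF that(1)] that(2) by (auto simp: hom_def)
  have hm: "\<phi> h (n \<otimes>\<^bsub>N\<^esub> n') = \<phi> h n \<otimes>\<^bsub>N\<^esub> \<phi> h n'"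
    if "h \<in> carrier H" "n \<in> carrier N" "n' \<in> carrier N" for h n n'
    using hom[OF that(1)] that by (auto simp: hom_def)
  show ?thesis
  proof (rule groupI)
    fix x assume x: "x \<in> carrier (semidirect N \<phi> H)"
    obtain n h where xe: "x = (n, h)" and n: "n \<in> carrier N" and h: "h \<in> carrier H"
      using x by (auto simp: semidirect_def)
    show "\<exists>y \<in> carrier (semidirect N \<phi> H). y \<otimes>\<^bsub>semidirect N \<phi> H\<^esub> x = \<one>\<^bsub>semidirect N \<phi> H\<^esub>"
      by (rule bexI[of _ "(inv\<^bsub>N\<^esub> (\<phi> (inv\<^bsub>H\<^esub> h) n), inv\<^bsub>H\<^esub> h)"])
        (use n h closed in \<open>auto simp: semidirect_def xe\<close>)
  qed (auto simp: semidirect_def closed hm one mult N.m_assoc H.m_assoc)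
qed


section \<open>The nine-dimensional algebra\<close>

datatype basis = E | X "2" | Y "2" | F "2" "2"

text \<open>Products of basis elements; \<open>None\<close> encodes the product zero.\<close>

fun basis_mult :: "basis \<Rightarrow> basis \<Rightarrow> basis option" where
  "basis_mult E E = Some E"
| "basis_mult (F i j) (F k r) = (if j = k then Some (F i r) else None)"
| "basis_mult E (X i) = Some (X i)"
| "basis_mult (X i) (F j r) = (if i = j then Some (X r) else None)"
| "basis_mult (F i j) (Y k) = (if j = k then Some (Y i) else None)"
| "basis_mult (Y i) E = Some (Y i)"
| "basis_mult _ _ = None"

text \<open>
  An element is its coordinate function with respect to the basis; multiplication is the bilinear
  extension of \<open>basis_mult\<close>. The identity element is \<open>E + F\<^sub>1\<^sub>1 + F\<^sub>2\<^sub>2\<close>.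
\<close>

definition algR :: "('k::field, basis \<Rightarrow> 'k) module" where
  "algR =
    \<lparr>carrier = UNIV,
     mult = (\<lambda>f g c. \<Sum>a\<in>UNIV. \<Sum>b\<in>UNIV. if basis_mult a b = Some c then f a * g b else 0),
     one = (\<lambda>c. if c = E \<or> c = F 1 1 \<or> c = F 2 2 then 1 else 0),
     zero = (\<lambda>_. 0),
     add = (\<lambda>f g c. f c + g c),
     smult = (\<lambda>k f c. k * f c)\<rparr>"

lemma UNIV_basis:
  "(UNIV :: basis set) = {E, X 1, X 2, Y 1, Y 2, F 1 1, F 1 2, F 2 1, F 2 2}"
proof -
  have "b \<in> {E, X 1, X 2, Y 1, Y 2, F 1 1, F 1 2, F 2 1, F 2 2}" for b
    by (cases b) (use exhaust_2 in \<open>auto; metis\<close>)+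
  then show ?thesis by blast
qed

lemma card_basis: "card (UNIV :: basis set) = 9"
  by (simp add: UNIV_basis)

lemma all_basis:
  "(\<forall>b. P b) \<longleftrightarrow> P E \<and> P (X 1) \<and> P (X 2) \<and> P (Y 1) \<and> P (Y 2) \<and>
     P (F 1 1) \<and> P (F 1 2) \<and> P (F 2 1) \<and> P (F 2 2)"
  using UNIV_basis by (metis UNIV_I insertE empty_iff)

lemma algR_mult:
  fixes f g :: "basis \<Rightarrow> 'k::field"
  shows "(f \<otimes>\<^bsub>algR\<^esub> g) E = f E * g E"
    and "(f \<otimes>\<^bsub>algR\<^esub> g) (X r) = f E * g (X r) + (\<Sum>i\<in>UNIV. f (X i) * g (F i r))"
    and "(f \<otimes>\<^bsub>algR\<^esub> g) (Y i) = (\<Sum>j\<in>UNIV. f (F i j) * g (Y j)) + f (Y i) * g E"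
    and "(f \<otimes>\<^bsub>algR\<^esub> g) (F i r) = (\<Sum>j\<in>UNIV. f (F i j) * g (F j r))"
  using exhaust_2[of i] exhaust_2[of r]
  by (auto simp: algR_def UNIV_basis UNIV_2)

lemma algR_simps [simp]:
  "carrier algR = UNIV"
  "(f \<oplus>\<^bsub>algR\<^esub> g) c = f c + g c"
  "\<zero>\<^bsub>algR\<^esub> c = 0"
  "\<one>\<^bsub>algR\<^esub> c = (if c = E \<or> c = F 1 1 \<or> c = F 2 2 then 1 else 0)"
  "(k \<odot>\<^bsub>algR\<^esub> f) c = k * f c"
  by (simp_all add: algR_def)

lemma algR_basis_mult:
  "(\<lambda>c. if c = a then 1 else 0) \<otimes>\<^bsub>algR\<^esub> (\<lambda>c. if c = b then 1 else 0) =
   (\<lambda>c. if basis_mult a b = Some c then 1 else (0::'k::field))"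
proof -
  have fin: "finite (UNIV :: basis set)" by (simp add: UNIV_basis)
  have "(\<Sum>a'\<in>UNIV. \<Sum>b'\<in>UNIV. if basis_mult a' b' = Some c
          then (if a' = a then 1 else 0) * (if b' = b then 1 else (0::'k)) else 0) =
        (if basis_mult a b = Some c then 1 else 0)" for c
  proof -
    have "(\<Sum>a'\<in>UNIV. \<Sum>b'\<in>UNIV. if basis_mult a' b' = Some c
            then (if a' = a then 1 else 0) * (if b' = b then 1 else (0::'k)) else 0) =
          (\<Sum>a'\<in>UNIV. if a' = a then
             \<Sum>b'\<in>UNIV. if b' = b then (if basis_mult a b = Some c then 1 else 0) else 0 else 0)"
      by (intro sum.cong refl) (auto intro!: sum.cong sum.neutral)
    then show ?thesis using fin by simp
  qed
  then show ?thesis by (simp add: algR_def)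
qed

lemma ring_algR: "ring (algR :: ('k::field, basis \<Rightarrow> 'k) module)"
proof (rule ringI)
  show "abelian_group (algR :: ('k, basis \<Rightarrow> 'k) module)"
  proof (rule abelian_groupI)
    fix x :: "basis \<Rightarrow> 'k"
    show "\<exists>y\<in>carrier algR. y \<oplus>\<^bsub>algR\<^esub> x = \<zero>\<^bsub>algR\<^esub>"
      by (rule bexI[of _ "\<lambda>c. - x c"]) (auto simp: fun_eq_iff)
  qed (auto simp: fun_eq_iff)
  show "monoid (algR :: ('k, basis \<Rightarrow> 'k) module)"
    by (rule monoidI) (auto simp: fun_eq_iff all_basis algR_mult UNIV_2 algebra_simps)
qed (auto simp: fun_eq_iff all_basis algR_mult UNIV_2 algebra_simps)

lemma algR_smult_mult:
  fixes f g :: "basis \<Rightarrow> 'k::field"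
  shows "(k \<odot>\<^bsub>algR\<^esub> f) \<otimes>\<^bsub>algR\<^esub> g = k \<odot>\<^bsub>algR\<^esub> (f \<otimes>\<^bsub>algR\<^esub> g)"
    and "f \<otimes>\<^bsub>algR\<^esub> (k \<odot>\<^bsub>algR\<^esub> g) = k \<odot>\<^bsub>algR\<^esub> (f \<otimes>\<^bsub>algR\<^esub> g)"
  by (auto simp: fun_eq_iff all_basis algR_mult UNIV_2 algebra_simps)

lemma group_AlgAut_algR: "group (AlgAut (algR :: ('k::field, basis \<Rightarrow> 'k) module))"
  by (rule group_AlgAut[OF ring_algR]) simp

lemma normal_inner_auto_algR:
  "inner_auto algR \<lhd> AlgAut (algR :: ('k::field, basis \<Rightarrow> 'k) module)"
  by (rule normal_inner_auto[OF ring_algR]) (simp_all add: algR_smult_mult)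


section \<open>The groups acting\<close>

definition additive_group :: "'a::ab_group_add monoid" where
  "additive_group = \<lparr>carrier = UNIV, mult = (+), one = 0\<rparr>"

definition mult_group :: "'k::field monoid" where
  "mult_group = units_of \<lparr>carrier = UNIV, mult = (*), one = 1\<rparr>"

definition GL2 :: "('k::field ^ 2 ^ 2) monoid" where
  "GL2 = units_of \<lparr>carrier = UNIV, mult = (**), one = mat 1\<rparr>"

text \<open>
  Row vectors have type \<open>'k ^ 2\<close>, column vectors are \<open>2 \<times> 1\<close> matrices, of type \<open>'k ^ 1 ^ 2\<close>.
\<close>

fun act ::
    "'k::field \<times> ('k ^ 2 ^ 2) \<Rightarrow> ('k ^ 2) \<times> ('k ^ 1 ^ 2) \<Rightarrow> ('k ^ 2) \<times> ('k ^ 1 ^ 2)" where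
  "act (l, P) (x, y) = ((l *s x) v* matrix_inv P, P ** y)"

lemma carrier_mult_group: "carrier (mult_group :: 'k::field monoid) = {x. x \<noteq> 0}"
proof -
  have "\<exists>y. y * x = 1 \<and> x * y = 1" if "x \<noteq> 0" for x :: 'k
    using that by (intro exI[of _ "inverse x"]) simp
  then show ?thesis
    by (auto simp: mult_group_def units_of_def Units_def)
qed

lemma carrier_GL2: "carrier (GL2 :: ('k::field ^ 2 ^ 2) monoid) = {P. invertible P}"
  by (auto simp: GL2_def units_of_def Units_def invertible_def)

lemma group_additive_group: "group (additive_group :: 'a::ab_group_add monoid)"
proof (rule groupI)
  fix x :: 'a
  show "\<exists>y\<in>carrier additive_group. y \<otimes>\<^bsub>additive_group\<^esub> x = \<one>\<^bsub>additive_group\<^esub>"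
    by (rule bexI[of _ "- x"]) (auto simp: additive_group_def)
qed (auto simp: additive_group_def algebra_simps)

lemma group_mult_group: "group (mult_group :: 'k::field monoid)"
  unfolding mult_group_def by (rule monoid.units_group) (auto intro!: monoidI)

lemma group_GL2: "group (GL2 :: ('k::field ^ 2 ^ 2) monoid)"
  unfolding GL2_def
  by (rule monoid.units_group) (auto intro!: monoidI simp: matrix_mul_assoc)

lemma matrix_inv_eq:
  fixes A B :: "'k::field ^ 'n ^ 'n"
  assumes "A ** B = mat 1"
  shows "matrix_inv A = B"
proof -
  have BA: "B ** A = mat 1" using assms by (simp add: matrix_left_right_inverse)
  have "A ** matrix_inv A = mat 1 \<and> matrix_inv A ** A = mat 1"
    unfolding matrix_inv_def by (rule someI[of _ B]) (simp add: assms BA)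
  then have "B ** (A ** matrix_inv A) = B" by simp
  then show ?thesis by (simp add: matrix_mul_assoc BA)
qed

lemma matrix_inv_mult:
  fixes P Q :: "'k::field ^ 'n ^ 'n"
  assumes "invertible P" "invertible Q"
  shows "matrix_inv (P ** Q) = matrix_inv Q ** matrix_inv P"
proof -
  obtain P' Q' where P': "P ** P' = mat 1" and Q': "Q ** Q' = mat 1"
    using assms by (auto simp: invertible_def)
  have "(P ** Q) ** (Q' ** P') = P ** (Q ** Q') ** P'" by (simp add: matrix_mul_assoc)
  then have "matrix_inv (P ** Q) = Q' ** P'"
    by (intro matrix_inv_eq) (simp add: P' Q')
  then show ?thesis by (simp add: matrix_inv_eq[OF P'] matrix_inv_eq[OF Q'])
qed

lemma mult_mult_group: "x \<otimes>\<^bsub>mult_group\<^esub> y = x * y"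
  by (simp add: mult_group_def units_of_def)

lemma mult_GL2: "P \<otimes>\<^bsub>GL2\<^esub> Q = P ** Q"
  by (simp add: GL2_def units_of_def)

lemma group_semidirect_act:
  "group (semidirect ((additive_group :: ('k::field ^ 2) monoid) \<times>\<times> (additive_group :: ('k ^ 1 ^ 2) monoid)) act
     ((mult_group :: 'k monoid) \<times>\<times> (GL2 :: ('k ^ 2 ^ 2) monoid)))"
proof (rule group_semidirect)
  have smul: "(c *s x) v* A = c *s (x v* A)" for c and x :: "'k ^ 2" and A :: "'k ^ 2 ^ 2"
    by (simp add: vec_eq_iff vector_matrix_mult_def UNIV_2 algebra_simps)
  have vadd: "(x + y) v* A = x v* A + y v* A" for x y :: "'k ^ 2" and A :: "'k ^ 2 ^ 2"
    by (simp add: vec_eq_iff vector_matrix_mult_def UNIV_2 algebra_simps)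
  show "group ((additive_group :: ('k ^ 2) monoid) \<times>\<times> (additive_group :: ('k ^ 1 ^ 2) monoid))"
    by (intro DirProd_group group_additive_group)
  show "group ((mult_group :: 'k monoid) \<times>\<times> (GL2 :: ('k ^ 2 ^ 2) monoid))"
    by (intro DirProd_group group_mult_group group_GL2)
  fix h h' :: "'k \<times> ('k ^ 2 ^ 2)" and n :: "('k ^ 2) \<times> ('k ^ 1 ^ 2)"
  assume h: "h \<in> carrier (mult_group \<times>\<times> GL2)"
  show "act h \<in> hom (additive_group \<times>\<times> additive_group) (additive_group \<times>\<times> additive_group)"
    by (cases h) (auto simp: hom_def additive_group_def smul vadd matrix_add_ldistrib vector_add_ldistrib)
  assume h': "h' \<in> carrier (mult_group \<times>\<times> GL2)"
  show "act (h \<otimes>\<^bsub>mult_group \<times>\<times> GL2\<^esub> h') n = act h (act h' n)"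
    using h h'
    by (cases h; cases h'; cases n)
      (auto simp: carrier_GL2 mult_GL2 mult_mult_group smul matrix_inv_mult
        vector_smult_assoc matrix_mul_assoc vector_matrix_mul_assoc)
next
  fix n :: "('k ^ 2) \<times> ('k ^ 1 ^ 2)"
  have "matrix_inv (mat 1 :: 'k ^ 2 ^ 2) = mat 1"
    by (rule matrix_inv_eq) simp
  then show "act \<one>\<^bsub>mult_group \<times>\<times> GL2\<^esub> n = n"
    by (cases n) (simp add: mult_group_def GL2_def units_of_def)
qed

end

theory Submission
  imports Defs
begin

text \<open>
  In block form an element is \<open>(e, x, y, f)\<close> with \<open>x\<close> a row, \<open>y\<close> a column and \<open>f\<close> a
  \<open>2 \<times> 2\<close> matrix, and the span of the \<open>X\<^sub>i\<close> and \<open>Y\<^sub>i\<close> is an ideal of square zero.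
  Any automorphism sends \<open>E\<close> to some \<open>(1, a, b, 0)\<close>, so that conjugation by an element
  \<open>1 + j\<close> with \<open>j\<close> in this ideal makes it fix \<open>E\<close>. It then preserves the Peirce blocks.
  Writing its action on columns as \<open>y \<mapsto> P y\<close>, compatibility with \<open>f y\<close> forces
  \<open>f \<mapsto> P f P\<^sup>-\<^sup>1\<close>, and compatibility with \<open>x f\<close> forces \<open>x \<mapsto> l x P\<^sup>-\<^sup>1\<close> for a
  scalar \<open>l\<close>. The inner automorphisms are precisely those with \<open>l = 1\<close>.
\<close>

section \<open>Block coordinates and matrix arithmetic\<close>

definition blk :: "'k::field \<Rightarrow> 'k ^ 2 \<Rightarrow> 'k ^ 1 ^ 2 \<Rightarrow> 'k ^ 2 ^ 2 \<Rightarrow> basis \<Rightarrow> 'k" where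
  "blk e x y f b = (case b of E \<Rightarrow> e | X i \<Rightarrow> x $ i | Y i \<Rightarrow> y $ i $ 1 | F i j \<Rightarrow> f $ i $ j)"

lemma blk_simps [simp]:
  "blk e x y f E = e" "blk e x y f (X i) = x $ i"
  "blk e x y f (Y i) = y $ i $ 1" "blk e x y f (F i j) = f $ i $ j"
  by (simp_all add: blk_def)

lemma blk_eq_iff [simp]:
  "blk e x y f = blk e' x' y' f' \<longleftrightarrow> e = e' \<and> x = x' \<and> y = y' \<and> f = f'"
  by (auto simp: fun_eq_iff all_basis vec_eq_iff forall_2 forall_1)

lemma blk_cases:
  fixes r :: "basis \<Rightarrow> 'k::field"
  obtains e x y f where "r = blk e x y f"
proof -
  have "r = blk (r E) (\<chi> i. r (X i)) (\<chi> i j. r (Y i)) (\<chi> i j. r (F i j))"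
    by (simp add: fun_eq_iff all_basis)
  with that show thesis by blast
qed

text \<open>All products \<open>X_i Y_j\<close> and \<open>Y_i X_j\<close> vanish, so rows and
  columns contribute nothing to the scalar and matrix components, which multiply independently.
  Columns are 2 x 1 matrices; a scalar therefore acts on them from the right as the 1 x 1 matrix
  \<open>mat e'\<close>.\<close>

lemma blk_mult [simp]:
  "blk e x y f \<otimes>\<^bsub>algR\<^esub> blk e' x' y' f' =
   blk (e * e') (e *s x' + x v* f') (f ** y' + y ** mat e') (f ** f')"
  by (simp add: fun_eq_iff all_basis algR_mult UNIV_2 UNIV_1 vector_matrix_mult_def
      matrix_matrix_mult_def mat_def algebra_simps)

lemma blk_add [simp]:
  "blk e x y f \<oplus>\<^bsub>algR\<^esub> blk e' x' y' f' = blk (e + e') (x + x') (y + y') (f + f')"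
  by (simp add: fun_eq_iff all_basis)

lemma blk_smult [simp]:
  "c \<odot>\<^bsub>algR\<^esub> blk e x y f = blk (c * e) (c *s x) (y ** mat c) (mat c ** f)"
  by (simp add: fun_eq_iff all_basis UNIV_2 UNIV_1 matrix_matrix_mult_def mat_def)

lemma one_blk: "\<one>\<^bsub>algR\<^esub> = blk 1 0 0 (mat 1)"
  by (simp add: fun_eq_iff all_basis mat_def)

lemma row_smult: "(c *s x) v* A = c *s (x v* A)" for x :: "'k::field ^ 2" and A :: "'k ^ 2 ^ 2"
  by (simp add: vec_eq_iff vector_matrix_mult_def UNIV_2 algebra_simps)

lemma row_add: "(x + y) v* A = x v* A + y v* A" for x :: "'k::field ^ 2" and A :: "'k ^ 2 ^ 2"
  by (simp add: vec_eq_iff vector_matrix_mult_def UNIV_2 algebra_simps)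

lemma row_diff: "(x - y) v* A = x v* A - y v* A" for x :: "'k::field ^ 2" and A :: "'k ^ 2 ^ 2"
  by (simp add: vec_eq_iff vector_matrix_mult_def UNIV_2 algebra_simps)

lemma matrix_diff_ldistrib: "A ** (B - C) = A ** B - A ** C" for A :: "'k::field ^ 'n ^ 'm"
  by (simp add: vec_eq_iff matrix_matrix_mult_def algebra_simps sum_subtractf)

lemma matrix_diff_rdistrib: "(B - C) ** A = B ** A - C ** A" for A :: "'k::field ^ 'n ^ 'm"
  by (simp add: vec_eq_iff matrix_matrix_mult_def algebra_simps sum_subtractf)

lemma matrix_add_rdistrib: "(B + C) ** A = B ** A + C ** A" for A :: "'k::field ^ 'n ^ 'm"
  by (simp add: vec_eq_iff matrix_matrix_mult_def algebra_simps sum.distrib)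

lemma mat_comm: "A ** mat c = mat c ** A" for A :: "'k::field ^ 2 ^ 2"
  by (simp add: vec_eq_iff matrix_matrix_mult_def UNIV_2 mat_def forall_2)

text \<open>Unit columns recover the entries. This form is needed because an automorphism reveals
  its matrix only through its action on the column block.\<close>

lemma matrix_eq_cols:
  fixes A B :: "'k::field ^ 2 ^ 2"
  assumes "\<And>y :: 'k ^ 1 ^ 2. A ** y = B ** y"
  shows "A = B"
proof -
  have "(A ** (\<chi> i j. if i = k then 1 else 0 :: 'k ^ 1 ^ 2)) $ i $ 1 = A $ i $ k"
    for A :: "'k ^ 2 ^ 2" and i k
    using exhaust_2[of k] by (auto simp: matrix_matrix_mult_def UNIV_2)
  then show ?thesis using assms by (metis vec_eq_iff)
qed

section \<open>Two families of automorphisms: conjugations by \<open>1 + j\<close> and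
  block-diagonal maps\<close>

fun unip :: "('k::field ^ 2) \<times> ('k ^ 1 ^ 2) \<Rightarrow> (basis \<Rightarrow> 'k) \<Rightarrow> basis \<Rightarrow> 'k" where
  "unip (a, b) r = blk 1 a b (mat 1) \<otimes>\<^bsub>algR\<^esub> r \<otimes>\<^bsub>algR\<^esub> blk 1 (- a) (- b) (mat 1)"

lemma unip_blk:
  "unip (a, b) (blk e x y f) = blk e (x + a v* f - e *s a) (y + b ** mat e - f ** b) f"
  by (simp add: vec_eq_iff forall_2 forall_1 UNIV_2 UNIV_1 vector_matrix_mult_def
      matrix_matrix_mult_def mat_def algebra_simps)

text \<open>The blocks are read off from coordinates because \<open>blk\<close> is not a constructor
  to match on. The index \<open>j\<close> in \<open>r (Y i)\<close> ranges over a one-element type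
  and only turns the coordinates into a 2 x 1 matrix.\<close>

fun diag :: "'k::field \<times> ('k ^ 2 ^ 2) \<Rightarrow> (basis \<Rightarrow> 'k) \<Rightarrow> basis \<Rightarrow> 'k" where
  "diag (l, P) r = blk (r E) ((l *s (\<chi> i. r (X i))) v* matrix_inv P) (P ** (\<chi> i j. r (Y i)))
     (P ** (\<chi> i j. r (F i j)) ** matrix_inv P)"

lemma diag_blk:
  "diag (l, P) (blk e x y f) = blk e ((l *s x) v* matrix_inv P) (P ** y) (P ** f ** matrix_inv P)"
proof -
  have "(\<chi> i j. y $ i $ 1) = y" by (simp add: vec_eq_iff forall_1)
  then show ?thesis by simp
qed

declare unip.simps [simp del] diag.simps [simp del]

lemma matrix_inv_both:
  fixes P :: "'k::field ^ 'n ^ 'n"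
  assumes "invertible P"
  shows "P ** matrix_inv P = mat 1" "matrix_inv P ** P = mat 1"
  using assms matrix_inv_eq by (metis invertible_def)+

lemma matrix_inv_cancel:
  fixes P :: "'k::field ^ 'n ^ 'n"
  assumes "invertible P"
  shows "A ** matrix_inv P ** P = A" "A ** P ** matrix_inv P = A"
  by (simp_all add: matrix_inv_both[OF assms] flip: matrix_mul_assoc)

text \<open>With \<open>j = blk 0 a b 0\<close>, \<open>unip (a, b)\<close> is conjugation by
  \<open>1 + j\<close>, whose inverse is \<open>1 - j\<close>. Products of two such \<open>j\<close>
  vanish, so \<open>(1 + j)(1 + j') = 1 + j + j'\<close>: multiplication of units becomes addition
  of parameters.\<close>

lemma unip_unip: "unip n (unip n' r) = unip (n + n') r"
  by (cases n; cases n'; cases r rule: blk_cases)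
    (simp add: unip_blk vec_eq_iff forall_2 forall_1 UNIV_2 UNIV_1 vector_matrix_mult_def
      matrix_matrix_mult_def mat_def algebra_simps)

lemma unip_0: "unip 0 r = r"
  by (cases r rule: blk_cases) (simp add: zero_prod_def unip_blk)

lemma diag_diag:
  assumes "invertible P" "invertible P'"
  shows "diag (l, P) (diag (l', P') r) = diag (l * l', P ** P') r"
  using assms
  by (cases r rule: blk_cases)
    (simp add: diag_blk row_smult vector_smult_assoc matrix_inv_mult matrix_mul_assoc
      vector_matrix_mul_assoc)

lemma diag_1: "diag (1, mat 1) r = r"
proof -
  have "matrix_inv (mat 1 :: 'a ^ 2 ^ 2) = mat 1" by (rule matrix_inv_eq) simp
  then show ?thesis by (cases r rule: blk_cases) (simp add: diag_blk)
qed

text \<open>\<open>diag (l, P)\<close> is multiplicative and sends the unit \<open>1 + j\<close>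
  with parameter \<open>n\<close> to the one with parameter \<open>act (l, P) n\<close>. This is
  where the action in the semidirect product comes from.\<close>

lemma diag_unip:
  assumes "invertible P"
  shows "diag (l, P) (unip n r) = unip (act (l, P) n) (diag (l, P) r)"
proof (cases n; cases r rule: blk_cases)
  fix a b e x y f
  assume [simp]: "n = (a, b)" "r = blk e x y f"
  note inv = matrix_inv_both[OF assms]
  have "a v* matrix_inv P v* (P ** f ** matrix_inv P) = a v* f v* matrix_inv P"
    by (simp add: vector_matrix_mul_assoc matrix_mul_assoc inv)
  then show ?thesis
    by (simp add: matrix_inv_cancel assms unip_blk diag_blk row_smult row_add row_diff vector_smult_assoc mult.commute
        vector_add_ldistrib vector_ssub_ldistrib matrix_mul_assoc matrix_add_ldistrib
        matrix_diff_ldistrib)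
qed

lemma alg_autoI:
  fixes f :: "(basis \<Rightarrow> 'k::field) \<Rightarrow> basis \<Rightarrow> 'k"
  assumes "bij f" "f \<one>\<^bsub>algR\<^esub> = \<one>\<^bsub>algR\<^esub>"
    "\<And>r s. f (r \<otimes>\<^bsub>algR\<^esub> s) = f r \<otimes>\<^bsub>algR\<^esub> f s"
    "\<And>r s. f (r \<oplus>\<^bsub>algR\<^esub> s) = f r \<oplus>\<^bsub>algR\<^esub> f s"
    "\<And>c r. f (c \<odot>\<^bsub>algR\<^esub> r) = c \<odot>\<^bsub>algR\<^esub> f r"
  shows "f \<in> alg_auto algR"
  using assms by (auto simp: alg_auto_def ring_iso_def ring_hom_def)

lemma alg_autoD:
  fixes f :: "(basis \<Rightarrow> 'k::field) \<Rightarrow> basis \<Rightarrow> 'k"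
  assumes "f \<in> alg_auto algR"
  shows "bij f" "f \<one>\<^bsub>algR\<^esub> = \<one>\<^bsub>algR\<^esub>"
    "f (r \<otimes>\<^bsub>algR\<^esub> s) = f r \<otimes>\<^bsub>algR\<^esub> f s"
    "f (r \<oplus>\<^bsub>algR\<^esub> s) = f r \<oplus>\<^bsub>algR\<^esub> f s"
    "f (c \<odot>\<^bsub>algR\<^esub> r) = c \<odot>\<^bsub>algR\<^esub> f r"
  using assms by (auto simp: alg_auto_def ring_iso_def ring_hom_def)

lemma unip_auto: "unip n \<in> alg_auto algR"
proof (rule alg_autoI)
  show "bij (unip n)"
    by (rule o_bij[of "unip (- n)"]) (simp_all add: fun_eq_iff unip_unip unip_0)
  show "unip n \<one>\<^bsub>algR\<^esub> = \<one>\<^bsub>algR\<^esub>"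
    by (cases n) (simp add: one_blk unip_blk)
next
  fix r s :: "basis \<Rightarrow> 'a" and c :: 'a
  obtain a b where n: "n = (a, b)" by fastforce
  obtain e x y f where r: "r = blk e x y f" by (rule blk_cases)
  obtain e' x' y' f' where s: "s = blk e' x' y' f'" by (rule blk_cases)
  show "unip n (r \<otimes>\<^bsub>algR\<^esub> s) = unip n r \<otimes>\<^bsub>algR\<^esub> unip n s"
    "unip n (r \<oplus>\<^bsub>algR\<^esub> s) = unip n r \<oplus>\<^bsub>algR\<^esub> unip n s"
    "unip n (c \<odot>\<^bsub>algR\<^esub> r) = c \<odot>\<^bsub>algR\<^esub> unip n r"
    by (simp_all add: n r s unip_blk vec_eq_iff forall_2 forall_1 UNIV_2 UNIV_1
        vector_matrix_mult_def matrix_matrix_mult_def mat_def algebra_simps)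
qed

lemma diag_auto:
  assumes "l \<noteq> 0" "invertible P"
  shows "diag (l, P) \<in> alg_auto algR"
proof (rule alg_autoI)
  note inv = matrix_inv_both[OF assms(2)]
  have "invertible (matrix_inv P)" using inv by (auto simp: invertible_def)
  then show "bij (diag (l, P))"
    by (intro o_bij[of "diag (1 / l, matrix_inv P)"])
      (simp_all add: fun_eq_iff diag_diag assms inv diag_1)
  show "diag (l, P) \<one>\<^bsub>algR\<^esub> = \<one>\<^bsub>algR\<^esub>"
    by (simp add: one_blk diag_blk inv)
  fix r s :: "basis \<Rightarrow> 'a" and c :: 'a
  obtain e x y f where r: "r = blk e x y f" by (rule blk_cases)
  obtain e' x' y' f' where s: "s = blk e' x' y' f'" by (rule blk_cases)
  have "x v* matrix_inv P v* (P ** f' ** matrix_inv P) = x v* f' v* matrix_inv P"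
    by (simp add: vector_matrix_mul_assoc matrix_mul_assoc inv)
  then show "diag (l, P) (r \<otimes>\<^bsub>algR\<^esub> s) = diag (l, P) r \<otimes>\<^bsub>algR\<^esub> diag (l, P) s"
    by (simp add: matrix_inv_cancel assms r s diag_blk row_smult row_add vector_smult_assoc mult.commute
        vector_add_ldistrib matrix_mul_assoc matrix_add_ldistrib)
  show "diag (l, P) (r \<oplus>\<^bsub>algR\<^esub> s) = diag (l, P) r \<oplus>\<^bsub>algR\<^esub> diag (l, P) s"
    by (simp add: r s diag_blk row_smult row_add vector_add_ldistrib matrix_add_ldistrib
        matrix_add_rdistrib)
  show "diag (l, P) (c \<odot>\<^bsub>algR\<^esub> r) = c \<odot>\<^bsub>algR\<^esub> diag (l, P) r"
    by (simp add: r diag_blk row_smult vector_smult_assoc mult.commute matrix_mul_assoc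
        mat_comm[of P])
qed

lemma alg_auto_comp:
  fixes f g :: "(basis \<Rightarrow> 'k::field) \<Rightarrow> basis \<Rightarrow> 'k"
  assumes "f \<in> alg_auto algR" "g \<in> alg_auto algR"
  shows "f \<circ> g \<in> alg_auto algR"
  by (rule alg_autoI) (simp_all add: alg_autoD[OF assms(1)] alg_autoD[OF assms(2)] bij_comp)

lemma AlgAut_simps:
  fixes f g :: "(basis \<Rightarrow> 'k::field) \<Rightarrow> basis \<Rightarrow> 'k"
  shows "carrier (AlgAut (algR :: ('k, basis \<Rightarrow> 'k) module)) = alg_auto algR"
    and "\<lbrakk>f \<in> alg_auto algR; g \<in> alg_auto algR\<rbrakk> \<Longrightarrow> f \<otimes>\<^bsub>AlgAut algR\<^esub> g = f \<circ> g"
  by (auto simp: AlgAut_def BijGroup_def Bij_def compose_def alg_autoD)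

section \<open>Every automorphism is a conjugation composed with a block-diagonal map\<close>

lemma prime_matrix:
  fixes A B :: "'k::field ^ 2 ^ 2"
  assumes "\<And>C. A ** C ** B = 0"
  shows "A = 0 \<or> B = 0"
proof (rule ccontr)
  assume "\<not> ?thesis"
  then obtain i j k l where nz: "A $ i $ j \<noteq> 0" "B $ k $ l \<noteq> 0"
    by (auto simp: vec_eq_iff)
  \<comment> \<open>The matrix unit at \<open>(j, k)\<close> isolates one entry of each
    factor.\<close>
  define C :: "'k ^ 2 ^ 2" where "C = (\<chi> p q. if p = j \<and> q = k then 1 else 0)"
  have "(A ** C ** B) $ i $ l = A $ i $ j * B $ k $ l"
    using exhaust_2[of j] exhaust_2[of k] by (auto simp: C_def matrix_matrix_mult_def UNIV_2)
  with nz show False by (simp add: assms)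
qed

text \<open>
  The corner \<open>e \<otimes> R \<otimes> e\<close> with \<open>e\<close> the image of \<open>E\<close> is commutative and
  \<open>e \<otimes> R \<otimes> (1 - e) \<otimes> R \<otimes> e = 0\<close>; as \<open>M\<^sub>2(K)\<close> is a prime noncommutative
  ring, this forces the matrix component of \<open>e\<close> to vanish.
\<close>
lemma alg_auto_E:
  fixes \<phi> :: "(basis \<Rightarrow> 'k::field) \<Rightarrow> basis \<Rightarrow> 'k"
  assumes \<phi>: "\<phi> \<in> alg_auto algR"
  obtains a b where "\<phi> (blk 1 0 0 0) = blk 1 a b 0"
proof -
  note D = alg_autoD[OF \<phi>]
  let ?E = "blk 1 0 0 0 :: basis \<Rightarrow> 'k"
  obtain e x y f where e: "\<phi> ?E = blk e x y f" by (rule blk_cases)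
  have surj: "\<exists>r. \<phi> r = s" for s using D(1) by (metis bij_pointE)
  have idem: "e * e = e" "f ** f = f"
    using D(3)[of ?E ?E] by (auto simp: e)
  have comm: "f ** A ** f ** B ** f = f ** B ** f ** A ** f" for A B
  proof -
    obtain r s where rs: "\<phi> r = blk 0 0 0 A" "\<phi> s = blk 0 0 0 B" using surj by metis
    have "?E \<otimes>\<^bsub>algR\<^esub> r \<otimes>\<^bsub>algR\<^esub> ?E \<otimes>\<^bsub>algR\<^esub> s \<otimes>\<^bsub>algR\<^esub> ?E =
          ?E \<otimes>\<^bsub>algR\<^esub> s \<otimes>\<^bsub>algR\<^esub> ?E \<otimes>\<^bsub>algR\<^esub> r \<otimes>\<^bsub>algR\<^esub> ?E"
      by (cases r rule: blk_cases; cases s rule: blk_cases) simp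
    from arg_cong[OF this, of \<phi>] show ?thesis by (simp add: D(3) e rs)
  qed
  have corner: "f ** A ** (mat 1 - f) ** B ** f = 0" for A B
  proof -
    obtain r s where rs: "\<phi> r = blk 0 0 0 A" "\<phi> s = blk 0 0 0 B" using surj by metis
    have "?E \<otimes>\<^bsub>algR\<^esub> r \<otimes>\<^bsub>algR\<^esub> s \<otimes>\<^bsub>algR\<^esub> ?E =
          ?E \<otimes>\<^bsub>algR\<^esub> r \<otimes>\<^bsub>algR\<^esub> ?E \<otimes>\<^bsub>algR\<^esub> s \<otimes>\<^bsub>algR\<^esub> ?E"
      by (cases r rule: blk_cases; cases s rule: blk_cases) simp
    from arg_cong[OF this, of \<phi>] show ?thesis
      by (simp add: D(3) e rs matrix_diff_ldistrib matrix_diff_rdistrib)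
  qed
  have "f = 0 \<or> mat 1 - f = 0"
  proof -
    \<comment> \<open>Primeness is used twice: first with left factor
      \<open>f ** A ** (mat 1 - f)\<close> and right factor \<open>f\<close>, then, if
      \<open>f\<close> is nonzero, with \<open>f\<close> and \<open>mat 1 - f\<close>.\<close>
    have "f ** A ** (mat 1 - f) = 0 \<or> f = 0" for A
      by (rule prime_matrix) (rule corner)
    then show ?thesis using prime_matrix by blast
  qed
  moreover have "f \<noteq> mat 1"
  proof
    assume "f = mat 1"
    then have c: "A ** B = B ** A" for A B :: "'k ^ 2 ^ 2" using comm[of A B] by simp
    \<comment> \<open>Matrix units: \<open>e_11 e_12 = e_12\<close>, whereas
      \<open>e_12 e_11 = 0\<close>.\<close>
    have "A ** B \<noteq> B ** A"
      if "A = (\<chi> i j. if i = 1 \<and> j = 1 then 1 else 0)"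
        "B = (\<chi> i j. if i = 1 \<and> j = 2 then 1 else 0)" for A B :: "'k ^ 2 ^ 2"
      by (simp add: that vec_eq_iff forall_2 matrix_matrix_mult_def UNIV_2)
    then show False using c by blast
  qed
  ultimately have f0: "f = 0" by auto
  have "e \<noteq> 0"
  proof
    assume "e = 0"
    \<comment> \<open>With \<open>e = 0\<close> and \<open>f = 0\<close> the image of
      \<open>E\<close> squares to zero, so injectivity would make the idempotent \<open>E\<close>
      vanish.\<close>
    then have "\<phi> (?E \<otimes>\<^bsub>algR\<^esub> ?E) = \<phi> (0 \<odot>\<^bsub>algR\<^esub> ?E)"
      unfolding D(3) D(5) by (simp add: e f0)
    then have "?E \<otimes>\<^bsub>algR\<^esub> ?E = 0 \<odot>\<^bsub>algR\<^esub> ?E"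
      using D(1) by (metis bij_pointE)
    then show False by simp
  qed
  with idem have "e = 1" by simp
  with e f0 that show thesis by simp
qed


lemma alg_auto_fix_E:
  fixes \<psi> :: "(basis \<Rightarrow> 'k::field) \<Rightarrow> basis \<Rightarrow> 'k"
  assumes \<psi>: "\<psi> \<in> alg_auto algR" and E: "\<psi> (blk 1 0 0 0) = blk 1 0 0 0"
  obtains l P where "l \<noteq> 0" "invertible P" "\<psi> = diag (l, P)"
proof -
  note D = alg_autoD[OF \<psi>]
  let ?E = "blk 1 0 0 0 :: basis \<Rightarrow> 'k"
  have zero: "\<psi> (blk 0 0 0 0) = blk 0 0 0 0"
    using D(5)[of 0 ?E] by (simp add: E)
  have inj: "\<psi> r = \<psi> s \<Longrightarrow> r = s" for r s using D(1) by (metis bij_pointE)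
  \<comment> \<open>The row block consists of the \<open>r\<close> with \<open>E r = r\<close> and
    \<open>r E = 0\<close>, conditions that survive under \<open>\<psi>\<close>. The column block is
    cut out by \<open>E r = 0\<close>, \<open>r E = r\<close>, and the matrix block by
    \<open>E r = r E = 0\<close>.\<close>
  have "\<exists>x'. \<psi> (blk 0 x 0 0) = blk 0 x' 0 0" for x
    using D(3)[of ?E "blk 0 x 0 0"] D(3)[of "blk 0 x 0 0" ?E]
    by (cases "\<psi> (blk 0 x 0 0)" rule: blk_cases) (simp add: E zero)
  then obtain X' where X': "\<psi> (blk 0 x 0 0) = blk 0 (X' x) 0 0" for x by metis
  have "\<exists>y'. \<psi> (blk 0 0 y 0) = blk 0 0 y' 0" for y
    using D(3)[of ?E "blk 0 0 y 0"] D(3)[of "blk 0 0 y 0" ?E]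
    by (cases "\<psi> (blk 0 0 y 0)" rule: blk_cases) (simp add: E zero)
  then obtain Y' where Y': "\<psi> (blk 0 0 y 0) = blk 0 0 (Y' y) 0" for y by metis
  have "\<exists>f'. \<psi> (blk 0 0 0 f) = blk 0 0 0 f'" for f
    using D(3)[of ?E "blk 0 0 0 f"] D(3)[of "blk 0 0 0 f" ?E]
    by (cases "\<psi> (blk 0 0 0 f)" rule: blk_cases) (simp add: E zero)
  then obtain F' where F': "\<psi> (blk 0 0 0 f) = blk 0 0 0 (F' f)" for f by metis
  have Y_add: "Y' (y + z) = Y' y + Y' z" for y z
    using D(4)[of "blk 0 0 y 0" "blk 0 0 z 0"] by (simp add: Y')
  have Y_smult: "Y' (y ** mat c) = Y' y ** mat c" for y c
    using D(5)[of c "blk 0 0 y 0"] by (simp add: Y')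
  \<comment> \<open>The unit columns; their images are the columns of \<open>P\<close>.\<close>
  define u :: "2 \<Rightarrow> 'k ^ 1 ^ 2" where "u k = (\<chi> i j. if i = k then 1 else 0)" for k
  define P :: "'k ^ 2 ^ 2" where "P = (\<chi> i k. Y' (u k) $ i $ 1)"
  have Y_P: "Y' y = P ** y" for y
  proof -
    have "y = u 1 ** mat (y $ 1 $ 1) + u 2 ** mat (y $ 2 $ 1)"
      by (simp add: u_def vec_eq_iff forall_2 forall_1 matrix_matrix_mult_def UNIV_1 mat_def)
    then have "Y' y = Y' (u 1) ** mat (y $ 1 $ 1) + Y' (u 2) ** mat (y $ 2 $ 1)"
      by (metis Y_add Y_smult)
    then show ?thesis
      by (simp add: P_def vec_eq_iff forall_2 forall_1 matrix_matrix_mult_def UNIV_1 UNIV_2 mat_def)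
  qed
  \<comment> \<open>A vector in the kernel of \<open>P\<close>, viewed as a column, yields an
    element sent to zero by the injective \<open>\<psi>\<close>.\<close>
  have P: "invertible P"
    unfolding invertible_left_inverse matrix_left_invertible_ker
  proof (intro allI impI)
    fix v assume v: "P *v v = 0"
    let ?y = "\<chi> i j. v $ i :: 'k ^ 1 ^ 2"
    have "P ** ?y = 0"
      using v by (simp add: vec_eq_iff matrix_matrix_mult_def matrix_vector_mult_def)
    then have "\<psi> (blk 0 0 ?y 0) = \<psi> (blk 0 0 0 0)" by (simp add: Y' Y_P zero)
    from inj[OF this] show "v = 0" by (simp add: vec_eq_iff)
  qed
  have F_P: "F' f = P ** f ** matrix_inv P" for f
  proof -
    \<comment> \<open>Applying \<open>\<psi>\<close> to the product of \<open>f\<close> and a column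
      \<open>y\<close> gives \<open>F' f (P y) = P (f y)\<close>.\<close>
    have "F' f ** P = P ** f"
    proof (rule matrix_eq_cols)
      fix y :: "'k ^ 1 ^ 2"
      show "F' f ** P ** y = P ** f ** y"
        using D(3)[of "blk 0 0 0 f" "blk 0 0 y 0"] by (simp add: Y' F' Y_P matrix_mul_assoc)
    qed
    then show ?thesis by (metis matrix_inv_cancel(2)[OF P])
  qed
  \<comment> \<open>Let \<open>B\<close> have first row \<open>x\<close> and second row zero. Then
    \<open>x = e_1 B\<close>, hence \<open>X' x = X' e_1 P B P^-1\<close>; since
    \<open>w B = w_1 x\<close> for every row \<open>w\<close>, the scalar must be the first entry of
    \<open>X' e_1 P\<close>.\<close>
  define l where "l = (X' (axis 1 1) v* P) $ 1"
  have X_l: "X' x = (l *s x) v* matrix_inv P" for x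
  proof -
    define B :: "'k ^ 2 ^ 2" where "B = (\<chi> i j. if i = 1 then x $ j else 0)"
    have "x = axis 1 1 v* B"
      by (simp add: B_def vec_eq_iff vector_matrix_mult_def UNIV_2 axis_def)
    then have "X' x = X' (axis 1 1) v* F' B"
      using D(3)[of "blk 0 (axis 1 1) 0 0" "blk 0 0 0 B"] by (simp add: X' F')
    also have "\<dots> = ((X' (axis 1 1) v* P) v* B) v* matrix_inv P"
      by (simp add: F_P vector_matrix_mul_assoc)
    also have "(X' (axis 1 1) v* P) v* B = l *s x"
      by (simp add: l_def B_def vec_eq_iff vector_matrix_mult_def UNIV_2 mult.commute)
    finally show ?thesis .
  qed
  have "l \<noteq> 0"
  proof
    assume "l = 0"
    then have "\<psi> (blk 0 (axis 1 1) 0 0) = \<psi> (blk 0 0 0 0)" by (simp add: X' X_l zero)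
    from inj[OF this] show False by (simp add: axis_eq_0_iff)
  qed
  moreover have "\<psi> r = diag (l, P) r" for r
  proof (cases r rule: blk_cases)
    fix e x y f assume r: "r = blk e x y f"
    have "r = (e \<odot>\<^bsub>algR\<^esub> ?E) \<oplus>\<^bsub>algR\<^esub> blk 0 x 0 0 \<oplus>\<^bsub>algR\<^esub> blk 0 0 y 0 \<oplus>\<^bsub>algR\<^esub> blk 0 0 0 f"
      by (simp add: r)
    then have "\<psi> r = (e \<odot>\<^bsub>algR\<^esub> ?E) \<oplus>\<^bsub>algR\<^esub> \<psi> (blk 0 x 0 0) \<oplus>\<^bsub>algR\<^esub> \<psi> (blk 0 0 y 0) \<oplus>\<^bsub>algR\<^esub> \<psi> (blk 0 0 0 f)"
      by (simp only: D(4,5) E)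
    then show ?thesis by (simp add: r X' Y' F' X_l Y_P F_P diag_blk)
  qed
  ultimately show thesis using P that by blast
qed

section \<open>The isomorphism from the semidirect product\<close>

fun param :: "(('k::field ^ 2) \<times> ('k ^ 1 ^ 2)) \<times> ('k \<times> ('k ^ 2 ^ 2)) \<Rightarrow> (basis \<Rightarrow> 'k) \<Rightarrow> basis \<Rightarrow> 'k" where
  "param (n, h) = unip n \<circ> diag h"

abbreviation paramG :: "((('k::field ^ 2) \<times> ('k ^ 1 ^ 2)) \<times> ('k \<times> ('k ^ 2 ^ 2))) monoid" where
  "paramG \<equiv> semidirect (additive_group \<times>\<times> additive_group) act (mult_group \<times>\<times> GL2)"

lemma carrier_paramG:
  "carrier paramG = {(n, l, P). l \<noteq> 0 \<and> invertible P}"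
  by (auto simp: semidirect_def carrier_mult_group carrier_GL2 additive_group_def)

lemma mult_paramG:
  "(n, l, P) \<otimes>\<^bsub>paramG\<^esub> (n', l', P') = (n + act (l, P) n', l * l', P ** P')"
  by (cases n; cases n') (auto simp: semidirect_def mult_mult_group mult_GL2 additive_group_def)

lemma param_surj:
  fixes \<phi> :: "(basis \<Rightarrow> 'k::field) \<Rightarrow> basis \<Rightarrow> 'k"
  assumes \<phi>: "\<phi> \<in> alg_auto algR"
  shows "\<exists>z\<in>carrier paramG. \<phi> = param z"
proof -
  obtain a b where E: "\<phi> (blk 1 0 0 0) = blk 1 a b 0" using \<phi> by (rule alg_auto_E)
  \<comment> \<open>By \<open>unip_blk\<close>, \<open>unip\<close> subtracts its first parameter
    from the row of \<open>blk 1 a b 0\<close> and adds its second to the column; hence the opposite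
    signs.\<close>
  have "unip (a, - b) \<circ> \<phi> \<in> alg_auto algR"
    by (intro alg_auto_comp unip_auto \<phi>)
  moreover have "(unip (a, - b) \<circ> \<phi>) (blk 1 0 0 0) = blk 1 0 0 0"
    by (simp add: E unip_blk)
  ultimately obtain l P where lP: "l \<noteq> 0" "invertible P" "unip (a, - b) \<circ> \<phi> = diag (l, P)"
    by (rule alg_auto_fix_E)
  then have "\<phi> = unip (- (a, - b)) \<circ> diag (l, P)"
    by (simp add: unip_unip unip_0 fun_eq_iff del: uminus_Pair flip: lP(3))
  with lP(1,2) show ?thesis
    by (intro bexI[of _ "(- (a, - b), l, P)"]) (auto simp: carrier_paramG)
qed

text \<open>\<open>unip\<close> fixes pure rows and pure columns, so columns determine
  \<open>P\<close>, and rows then determine \<open>l\<close>. As \<open>diag\<close> fixes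
  \<open>E\<close>, the image of \<open>E\<close> determines \<open>a\<close> and
  \<open>b\<close>.\<close>

lemma param_inj: "inj_on param (carrier paramG)"
proof (rule inj_onI)
  fix z z' :: "(('k::field ^ 2) \<times> ('k ^ 1 ^ 2)) \<times> ('k \<times> ('k ^ 2 ^ 2))"
  assume z: "z \<in> carrier paramG" and z': "z' \<in> carrier paramG" and eq: "param z = param z'"
  obtain a b l P where z_eq: "z = ((a, b), l, P)" by (metis surj_pair)
  obtain a' b' l' P' where z'_eq: "z' = ((a', b'), l', P')" by (metis surj_pair)
  have P: "invertible P" using z by (simp add: z_eq carrier_paramG)
  have r: "param z r = param z' r" for r using eq by simp
  have "P = P'"
  proof (rule matrix_eq_cols)
    fix y :: "'k ^ 1 ^ 2"
    show "P ** y = P' ** y"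
      using r[of "blk 0 0 y 0"] by (simp add: z_eq z'_eq unip_blk diag_blk)
  qed
  moreover have "l *s x v* matrix_inv P = l' *s x v* matrix_inv P'" for x
    using r[of "blk 0 x 0 0"] by (simp add: z_eq z'_eq unip_blk diag_blk)
  then have "(l *s axis 1 1) v* matrix_inv P v* P = (l' *s axis 1 1) v* matrix_inv P v* P"
    using \<open>P = P'\<close> by simp
  then have "l = l'"
    by (simp add: vector_matrix_mul_assoc matrix_inv_both[OF P] vec_eq_iff forall_2 axis_def)
  moreover have "a = a' \<and> b = b'"
    using r[of "blk 1 0 0 0"] by (simp add: z_eq z'_eq unip_blk diag_blk)
  ultimately show "z = z'" by (simp add: z_eq z'_eq)
qed

lemma param_auto: "z \<in> carrier paramG \<Longrightarrow> param z \<in> alg_auto algR"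
  by (cases z) (auto simp: carrier_paramG intro!: alg_auto_comp unip_auto diag_auto)

lemma param_iso: "param \<in> iso paramG (AlgAut (algR :: ('k::field, basis \<Rightarrow> 'k) module))"
  unfolding iso_def
proof (intro CollectI conjI homI)
  show "bij_betw param (carrier paramG) (carrier (AlgAut (algR :: ('k, basis \<Rightarrow> 'k) module)))"
    unfolding bij_betw_def AlgAut_simps
    using param_inj param_auto param_surj by blast
  fix z z' :: "(('k ^ 2) \<times> ('k ^ 1 ^ 2)) \<times> ('k \<times> ('k ^ 2 ^ 2))"
  assume z: "z \<in> carrier paramG"
  then show "param z \<in> carrier (AlgAut algR)" by (simp add: AlgAut_simps param_auto)
  assume z': "z' \<in> carrier paramG"
  obtain n l P where z_eq: "z = (n, l, P)" by (metis surj_pair)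
  obtain n' l' P' where z'_eq: "z' = (n', l', P')" by (metis surj_pair)
  have P: "invertible P" "invertible P'"
    using z z' by (auto simp: z_eq z'_eq carrier_paramG)
  \<comment> \<open>Moving \<open>diag (l, P)\<close> past \<open>unip n'\<close> by
    \<open>diag_unip\<close> replaces \<open>n'\<close> by \<open>act (l, P) n'\<close>, which is
    the semidirect multiplication law.\<close>
  have "param (z \<otimes>\<^bsub>paramG\<^esub> z') = param z \<circ> param z'"
    by (simp add: fun_eq_iff z_eq z'_eq mult_paramG diag_unip P unip_unip diag_diag)
  then show "param (z \<otimes>\<^bsub>paramG\<^esub> z') = param z \<otimes>\<^bsub>AlgAut algR\<^esub> param z'"
    using z z' by (simp add: AlgAut_simps param_auto)
qed

section \<open>Inner automorphisms and the outer automorphism group\<close>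

lemma inner_auto_algR_iff:
  "f \<in> inner_auto (algR :: ('k::field, basis \<Rightarrow> 'k) module) \<longleftrightarrow>
   (\<exists>u v. u \<otimes>\<^bsub>algR\<^esub> v = \<one>\<^bsub>algR\<^esub> \<and> v \<otimes>\<^bsub>algR\<^esub> u = \<one>\<^bsub>algR\<^esub> \<and>
      f = (\<lambda>r. v \<otimes>\<^bsub>algR\<^esub> r \<otimes>\<^bsub>algR\<^esub> u))"
proof -
  interpret ring "algR :: ('k, basis \<Rightarrow> 'k) module" by (rule ring_algR)
  have unit: "u \<in> Units algR" "inv\<^bsub>algR\<^esub> u = v"
    if "u \<otimes>\<^bsub>algR\<^esub> v = \<one>\<^bsub>algR\<^esub>" "v \<otimes>\<^bsub>algR\<^esub> u = \<one>\<^bsub>algR\<^esub>" for u v :: "basis \<Rightarrow> 'k"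
    using that inv_unique'[of u v] by (auto simp: Units_def)
  show ?thesis
  proof
    assume "f \<in> inner_auto algR"
    then obtain u where "u \<in> Units algR"
      "f = (\<lambda>r. inv\<^bsub>algR\<^esub> u \<otimes>\<^bsub>algR\<^esub> r \<otimes>\<^bsub>algR\<^esub> u)"
      by (auto simp: inner_auto_def restrict_def)
    then show "\<exists>u v. u \<otimes>\<^bsub>algR\<^esub> v = \<one>\<^bsub>algR\<^esub> \<and> v \<otimes>\<^bsub>algR\<^esub> u = \<one>\<^bsub>algR\<^esub> \<and>
        f = (\<lambda>r. v \<otimes>\<^bsub>algR\<^esub> r \<otimes>\<^bsub>algR\<^esub> u)"
      using Units_l_inv Units_r_inv by blast
  next
    assume "\<exists>u v. u \<otimes>\<^bsub>algR\<^esub> v = \<one>\<^bsub>algR\<^esub> \<and> v \<otimes>\<^bsub>algR\<^esub> u = \<one>\<^bsub>algR\<^esub> \<and>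
        f = (\<lambda>r. v \<otimes>\<^bsub>algR\<^esub> r \<otimes>\<^bsub>algR\<^esub> u)"
    then obtain u v where uv: "u \<otimes>\<^bsub>algR\<^esub> v = \<one>\<^bsub>algR\<^esub>" "v \<otimes>\<^bsub>algR\<^esub> u = \<one>\<^bsub>algR\<^esub>"
      and f: "f = (\<lambda>r. v \<otimes>\<^bsub>algR\<^esub> r \<otimes>\<^bsub>algR\<^esub> u)" by blast
    show "f \<in> inner_auto algR"
      unfolding inner_auto_def f
      by (intro CollectI exI[of _ u]) (simp add: unit[OF uv] restrict_def)
  qed
qed

text \<open>A conjugation \<open>v r u\<close> with scalar parts \<open>e'\<close>, \<open>e\<close>
  and matrix parts \<open>g'\<close>, \<open>g\<close> sends pure columns \<open>y\<close> to
  \<open>g' y e\<close> and pure rows \<open>x\<close> to \<open>e' x g\<close>. Thus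
  \<open>P = e g'\<close> and \<open>P^-1 = e' g\<close>, which forces \<open>l = 1\<close>.
  Conversely, \<open>diag (1, P)\<close> is conjugation by a block-diagonal unit.\<close>

lemma inner_auto_param:
  "inner_auto algR = {param (n, 1, P) | n (P :: 'k::field ^ 2 ^ 2). invertible P}"
proof (intro equalityI subsetI)
  interpret ring "algR :: ('k, basis \<Rightarrow> 'k) module" by (rule ring_algR)
  fix f assume "f \<in> {param (n, 1, P) | n (P :: 'k ^ 2 ^ 2). invertible P}"
  then obtain a b P where f: "f = param ((a, b), 1, P)" and P: "invertible P" by auto
  note inv = matrix_inv_both[OF P]
  have diag: "diag (1, P) r = blk 1 0 0 P \<otimes>\<^bsub>algR\<^esub> r \<otimes>\<^bsub>algR\<^esub> blk 1 0 0 (matrix_inv P)" for r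
    by (cases r rule: blk_cases) (simp add: diag_blk)
  let ?v = "blk 1 a b (mat 1) \<otimes>\<^bsub>algR\<^esub> blk 1 0 0 P"
  let ?u = "blk 1 0 0 (matrix_inv P) \<otimes>\<^bsub>algR\<^esub> blk 1 (- a) (- b) (mat 1)"
  have "f = (\<lambda>r. ?v \<otimes>\<^bsub>algR\<^esub> r \<otimes>\<^bsub>algR\<^esub> ?u)"
    unfolding f param.simps comp_def unip.simps diag by (simp add: m_assoc del: blk_mult)
  moreover have "?u \<otimes>\<^bsub>algR\<^esub> ?v = \<one>\<^bsub>algR\<^esub>" "?v \<otimes>\<^bsub>algR\<^esub> ?u = \<one>\<^bsub>algR\<^esub>"
    by (simp_all add: one_blk inv vector_matrix_mul_assoc matrix_mul_assoc
        matrix_inv_cancel[OF P] flip: matrix_add_ldistrib row_add)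
  ultimately show "f \<in> inner_auto algR" unfolding inner_auto_algR_iff by blast
next
  fix f :: "(basis \<Rightarrow> 'k) \<Rightarrow> basis \<Rightarrow> 'k"
  assume f: "f \<in> inner_auto algR"
  then have "f \<in> alg_auto algR"
    using normal_inner_auto_algR normal_imp_subgroup subgroup.subset AlgAut_simps(1) by blast
  then obtain z where z: "z \<in> carrier paramG" "f = param z" using param_surj by blast
  obtain a b l P where "z = ((a, b), l, P)" by (metis surj_pair)
  with z have f_param: "f = param ((a, b), l, P)" and P: "invertible P"
    by (auto simp: carrier_paramG)
  obtain u v where uv: "u \<otimes>\<^bsub>algR\<^esub> v = \<one>\<^bsub>algR\<^esub>"
    and f_conj: "f = (\<lambda>r. v \<otimes>\<^bsub>algR\<^esub> r \<otimes>\<^bsub>algR\<^esub> u)"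
    using f inner_auto_algR_iff by blast
  obtain e x y g where u: "u = blk e x y g" by (rule blk_cases)
  obtain e' x' y' g' where v: "v = blk e' x' y' g'" by (rule blk_cases)
  have r: "param ((a, b), l, P) r = v \<otimes>\<^bsub>algR\<^esub> r \<otimes>\<^bsub>algR\<^esub> u" for r
    using f_param f_conj by metis
  have ee: "e * e' = 1" and gg: "g ** g' = mat 1"
    using uv by (simp_all add: u v one_blk)
  have "P = g' ** mat e"
  proof (rule matrix_eq_cols)
    fix z :: "'k ^ 1 ^ 2"
    have "P ** z = g' ** z ** mat e"
      using r[of "blk 0 0 z 0"] by (simp add: u v unip_blk diag_blk)
    also have "\<dots> = g' ** mat e ** z"
      by (simp add: vec_eq_iff forall_2 forall_1 UNIV_2 UNIV_1 matrix_matrix_mult_def mat_def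
          algebra_simps)
    finally show "P ** z = g' ** mat e ** z" .
  qed
  \<comment> \<open>The first row of \<open>l P^-1 = e' g\<close> is multiplied by \<open>P\<close>
    on the right: this side evaluates to \<open>e' e = 1\<close> times \<open>e_1\<close>, the other
    below to \<open>l\<close> times \<open>e_1\<close>.\<close>
  then have "(e' *s axis 1 1) v* g v* P = (e' *s axis 1 1) v* mat e"
    by (simp add: vector_matrix_mul_assoc matrix_mul_assoc gg)
  moreover have "(e' *s axis 1 1) v* g v* P = l *s axis 1 1"
  proof -
    have "(l *s axis 1 1) v* matrix_inv P = (e' *s axis 1 1) v* g"
      using r[of "blk 0 (axis 1 1) 0 0"] by (simp add: u v unip_blk diag_blk)
    then have "(e' *s axis 1 1) v* g v* P = (l *s axis 1 1) v* matrix_inv P v* P" by simp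
    then show ?thesis by (simp add: vector_matrix_mul_assoc matrix_inv_both[OF P])
  qed
  ultimately have "l *s axis 1 1 = (e' *s axis 1 1) v* (mat e :: 'k ^ 2 ^ 2)"
    by simp
  then have "l = 1"
    using ee by (simp add: vec_eq_iff forall_2 axis_def vector_matrix_mult_def UNIV_2 mat_def
        mult.commute)
  with f_param P show "f \<in> {param (n, 1, P) | n (P :: 'k ^ 2 ^ 2). invertible P}" by blast
qed

theorem theoremC:
  shows "AlgAut (algR :: ('k::field, basis \<Rightarrow> 'k) module)
           \<cong> semidirect ((additive_group :: ('k ^ 2) monoid) \<times>\<times> (additive_group :: ('k ^ 1 ^ 2) monoid)) act
               ((mult_group :: 'k monoid) \<times>\<times> (GL2 :: ('k ^ 2 ^ 2) monoid))
       \<and> AlgOut (algR :: ('k, basis \<Rightarrow> 'k) module) \<cong> (mult_group :: 'k monoid)"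
proof
  let ?A = "AlgAut (algR :: ('k, basis \<Rightarrow> 'k) module)"
  let ?S = "paramG :: ((('k ^ 2) \<times> ('k ^ 1 ^ 2)) \<times> ('k \<times> ('k ^ 2 ^ 2))) monoid"
  let ?M = "mult_group :: 'k monoid"
  have inv_iso: "inv_into (carrier ?S) param \<in> iso ?A ?S"
    by (rule group.iso_set_sym[OF group_semidirect_act param_iso])
  then show "?A \<cong> ?S" by (rule is_isoI)
  \<comment> \<open>\<open>h\<close> reads off the scalar \<open>l\<close>. It is a homomorphism
    because the scalars multiply in \<open>mult_paramG\<close>, and its kernel \<open>l = 1\<close>
    is the inner group by \<open>inner_auto_param\<close>; the first isomorphism theorem then
    applies.\<close>
  define h where "h = (\<lambda>z. fst (snd z)) \<circ> inv_into (carrier ?S) param"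
  have h_param: "h (param z) = fst (snd z)" if "z \<in> carrier ?S" for z
    using inv_into_f_f[OF param_inj that] by (simp add: h_def)
  have A: "carrier ?A = param ` carrier ?S"
    using param_iso by (auto simp: iso_def bij_betw_def)
  have "(\<lambda>z. fst (snd z)) \<in> hom ?S ?M"
    by (rule homI) (auto simp: carrier_paramG carrier_mult_group mult_paramG mult_mult_group)
  then have "h \<in> hom ?A ?M"
    unfolding h_def using inv_iso by (intro hom_compose) (auto simp: iso_def)
  then interpret h: group_hom ?A ?M h
    by (simp add: group_hom_def group_hom_axioms_def group_AlgAut_algR group_mult_group)
  have img: "h ` carrier ?A = carrier ?M"
  proof -
    have "l \<in> (\<lambda>z. fst (snd z)) ` carrier ?S" if "l \<noteq> 0" for l
      using that by (intro image_eqI[of _ _ "(0, l, mat 1)"])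
        (auto simp: carrier_paramG invertible_def intro!: exI[of _ "mat 1"])
    then have "(\<lambda>z. fst (snd z)) ` carrier ?S = carrier ?M"
      by (auto simp: carrier_paramG carrier_mult_group)
    then show ?thesis
      by (simp add: A image_image h_param cong: image_cong)
  qed
  have "kernel ?A ?M h = inner_auto algR"
  proof -
    have one_M: "\<one>\<^bsub>?M\<^esub> = 1" by (simp add: mult_group_def units_of_def)
    have "kernel ?A ?M h = param ` {z \<in> carrier ?S. h (param z) = 1}"
      unfolding kernel_def A one_M by blast
    also have "{z \<in> carrier ?S. h (param z) = 1} = {(n, 1, P) | n P. invertible P}"
      by (auto simp: h_param carrier_paramG simp del: param.simps)
    also have "param ` \<dots> = inner_auto algR"
      unfolding inner_auto_param by blast
    finally show ?thesis .
  qed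
  with h.FactGroup_iso[OF img] show "AlgOut (algR :: ('k, basis \<Rightarrow> 'k) module) \<cong> ?M"
    by (simp add: AlgOut_def)
qed

end
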